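(* Let $k\ge2$ be an integer and $q=p^r$ with $p$ prime and $r\ge1$. For $n\ge k$ let $\sigma_{n,k}\in\mathbb{F}_q[X_1,\dots,X_n]$ denote the elementary symmetric polynomial of degree $k$ in $n$ variables. Then the sequence $\{S_{\mathbb{F}_q}(\sigma_{n,k})\}$ satisfies a linear recurrence with constant coefficients.
   Context: For $F\in\mathbb{F}_q[X_1,\dots,X_n]$, $S_{\mathbb{F}_q}(F)=\sum_{\mathbf{x}\in\mathbb{F}_q^n}e^{\frac{2\pi i}{p}\mathrm{Tr}_{\mathbb{F}_q/\mathbb{F}_p}(F(\mathbf{x}))}$, with $\mathrm{Tr}_{\mathbb{F}_q/\mathbb{F}_p}$ the field trace. *)

theory Defs
  imports
    Complex_Main
    "HOL-Library.Cardinality"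
    "HOL-Library.FuncSet"
    "HOL-Library.Poly_Mapping"
    "HOL-Computational_Algebra.Polynomial"
    "HOL-Number_Theory.Cong"
begin

text \<open>
  Multivariate polynomials in the variables $X_0, X_1, X_2, \dots$ are finitely supported maps from
  monomials (finitely supported exponent vectors) to coefficients; the ring structure is that of
  \<^theory>\<open>HOL-Library.Poly_Mapping\<close>. A polynomial in $X_1, \dots, X_n$ is one whose monomials only
  involve indices in \<open>{1..n}\<close>.
\<close>

type_synonym 'a mpoly = "(nat \<Rightarrow>\<^sub>0 nat) \<Rightarrow>\<^sub>0 'a"

definition Var :: "nat \<Rightarrow> 'a::comm_semiring_1 mpoly" where
  "Var i = Poly_Mapping.single (Poly_Mapping.single i 1) 1"

definition mpoly_eval :: "(nat \<Rightarrow> 'a::comm_semiring_1) \<Rightarrow> 'a mpoly \<Rightarrow> 'a" where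
  "mpoly_eval x F =
     (\<Sum>m \<in> Poly_Mapping.keys F. Poly_Mapping.lookup F m *
        (\<Prod>i \<in> Poly_Mapping.keys m. x i ^ Poly_Mapping.lookup m i))"

definition elem_sym :: "nat \<Rightarrow> nat \<Rightarrow> 'a::comm_semiring_1 mpoly" where
  "elem_sym n k = (\<Sum>A | A \<subseteq> {1..n} \<and> card A = k. \<Prod>i\<in>A. Var i)"

text \<open>
  The field trace from the field with \<open>p ^ r\<close> elements to its prime field, i.e. the sum of the
  conjugates under the Galois group, which is generated by the Frobenius map. As an element of
  \<^typ>\<open>'a\<close> it lies in the prime field, see \<open>field_trace_in_prime_field\<close> below.
\<close>

definition field_trace :: "nat \<Rightarrow> nat \<Rightarrow> 'a::field \<Rightarrow> 'a" where
  "field_trace p r x = (\<Sum>j<r. x ^ (p ^ j))"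

text \<open>
  $e^{2 \pi i t / p}$ for a prime field element \<open>t\<close> refers to an integer representing \<open>t\<close>. Outside the
  prime field the value below is unspecified; it is only applied to traces.
\<close>

definition prime_field_rep :: "nat \<Rightarrow> 'a::field \<Rightarrow> nat" where
  "prime_field_rep p t = (THE m. m < p \<and> of_nat m = t)"

text \<open>
  The points of the affine \<open>n\<close>-space are the functions on \<open>{1..n}\<close>, extended by \<^const>\<open>undefined\<close>;
  \<open>F\<close> is meant to be a polynomial in $X_1, \dots, X_n$.
\<close>

definition exp_sum :: "nat \<Rightarrow> nat \<Rightarrow> nat \<Rightarrow> 'a::finite_field mpoly \<Rightarrow> complex" where
  "exp_sum p r n F =
     (\<Sum>x \<in> {1..n} \<rightarrow>\<^sub>E (UNIV :: 'a set).
        exp (2 * of_real pi * \<i> / of_nat p *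
             of_nat (prime_field_rep p (field_trace p r (mpoly_eval x F)))))"

text \<open>
  A sequence indexed by \<open>n \<ge> n0\<close> satisfies a (homogeneous) linear recurrence of order \<open>d \<ge> 1\<close>;
  the values of \<open>s\<close> below \<open>n0\<close> are irrelevant.
\<close>

definition satisfies_linear_recurrence_from :: "nat \<Rightarrow> (nat \<Rightarrow> 'a::comm_ring_1) \<Rightarrow> bool" where
  "satisfies_linear_recurrence_from n0 s \<longleftrightarrow>
     (\<exists>d>0. \<exists>c :: nat \<Rightarrow> 'a. \<forall>n\<ge>n0. s (n + d) = (\<Sum>j<d. c j * s (n + j)))"

lemma CHAR_of_card:
  assumes "prime p" "CARD('a::finite_field) = p ^ r"
  shows "CHAR('a) = p"
proof -
  have "(\<Sum>x\<in>(UNIV::'a set). x + 1) = (\<Sum>x\<in>UNIV. x)"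
    by (rule sum.reindex_bij_witness[of _ "\<lambda>x. x - 1" "\<lambda>x. x + 1"]) auto
  hence "(of_nat CARD('a) :: 'a) = 0"
    by (simp add: sum.distrib)
  hence "CHAR('a) dvd p ^ r"
    using assms(2) by (metis of_nat_eq_0_iff_char_dvd)
  moreover have "prime CHAR('a)"
    by (simp add: finite_imp_CHAR_pos prime_CHAR_semidom)
  ultimately show ?thesis
    using assms(1) by (meson prime_dvd_power primes_dvd_imp_eq)
qed

lemma prime_field_rep_unique:
  assumes "prime p" "CARD('a::finite_field) = p ^ r" "m < p"
  shows "prime_field_rep p (of_nat m :: 'a) = m"
  unfolding prime_field_rep_def
  using assms CHAR_of_card[OF assms(1,2)]
  by (intro the_equality) (auto simp: of_nat_eq_iff_cong_CHAR cong_def)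

lemma field_trace_in_prime_field:
  fixes x :: "'a::finite_field"
  assumes "prime p" "CARD('a) = p ^ r"
  shows "\<exists>!m. m < p \<and> of_nat m = field_trace p r x"
proof -
  note ch = CHAR_of_card[OF assms]
  let ?t = "field_trace p r x"
  let ?P = "monom 1 p - monom 1 1 :: 'a poly"
  have p1: "p > 1" using assms(1) prime_gt_1_nat by blast
  have "?t ^ p = (\<Sum>j<r. (x ^ (p ^ j)) ^ p)"
    unfolding field_trace_def using assms(1) ch by (intro freshmans_dream_sum) auto
  also have "\<dots> = (\<Sum>j<r. x ^ (p ^ Suc j))"
    by (simp only: power_mult[symmetric] power_Suc2)
  also have "\<dots> = ?t"
  proof -
    have "x ^ (p ^ r) = x ^ (p ^ 0)"
      using finite_field_power_card_eq_same[of x] assms(2) by simp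
    thus ?thesis
      unfolding field_trace_def
      using sum.lessThan_Suc_shift[of "\<lambda>j. x ^ (p ^ j)" r] sum.lessThan_Suc[of "\<lambda>j. x ^ (p ^ j)" r]
      by (metis add.commute add_left_cancel)
  qed
  finally have root: "?t ^ p = ?t" .
  have coeff: "coeff ?P p = 1" using p1 by simp
  have nz: "?P \<noteq> 0" using coeff by (metis coeff_0 zero_neq_one)
  have deg: "degree ?P \<le> p"
    using p1 by (intro degree_diff_le order.trans[OF degree_monom_le]) auto
  let ?N = "of_nat ` {..<p} :: 'a set"
  have inj: "inj_on (of_nat :: nat \<Rightarrow> 'a) {..<p}"
    using ch by (auto simp: inj_on_def of_nat_eq_iff_cong_CHAR cong_def)
  have sub: "?N \<subseteq> {y. poly ?P y = 0}"
  proof safe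
    fix m :: nat
    have "(\<Sum>i<m. 1 :: 'a) ^ p = (\<Sum>i<m. 1 ^ p)"
      using assms(1) ch by (intro freshmans_dream_sum) auto
    hence "(of_nat m :: 'a) ^ p = of_nat m" by simp
    thus "poly ?P (of_nat m) = 0" by (simp add: poly_monom)
  qed
  have "card {y. poly ?P y = 0} \<le> card ?N"
    using card_poly_roots_bound[OF nz] deg by (simp add: card_image[OF inj])
  hence "?N = {y. poly ?P y = 0}"
    using sub by (intro card_seteq) auto
  moreover have "poly ?P ?t = 0" using root by (simp add: poly_monom)
  ultimately obtain m where "m < p" "of_nat m = ?t" by (metis (mono_tags, lifting) imageE lessThan_iff mem_Collect_eq)
  thus ?thesis using inj by (metis inj_onD lessThan_iff)
qed

end

theory Submission
  imports Defs
begin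

text \<open>
  Adjoining a variable with value \<open>a\<close> replaces $\sigma_{n,j}$ by $\sigma_{n,j} + a\,\sigma_{n,j-1}$.
  The vector $(\sigma_{n,0}, \dots, \sigma_{n,k})$ of values therefore walks on a finite set of states,
  and the exponential sum is \<open>(T ^^ n) h\<close> evaluated at the initial state, where \<open>T\<close> is the linear
  transfer operator of the walk on complex functions of the state and \<open>h\<close> is the character of the
  last coordinate. These functions form a finite-dimensional space, so the iterates \<open>(T ^^ n) h\<close> are
  linearly dependent, and \<open>T\<close> propagates one linear relation to a recurrence.
\<close>

section \<open>Transfer operators on finite state spaces\<close>

text \<open>Gaussian elimination by induction on the equations: the elements of \<open>S\<close>
  index equations, those of \<open>J\<close> unknowns. A pivot \<open>i\<close> with
  \<open>a i s \<noteq> 0\<close> removes one equation and one unknown, which preserves the strict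
  inequality.\<close>

lemma homogeneous_system_nontrivial_solution:
  fixes a :: "'j \<Rightarrow> 's \<Rightarrow> 'f::field"
  assumes "finite S" "finite J" "card S < card J"
  shows "\<exists>c. (\<exists>j\<in>J. c j \<noteq> 0) \<and> (\<forall>s\<in>S. (\<Sum>j\<in>J. c j * a j s) = 0)"
  using assms
proof (induction S arbitrary: J a rule: finite_induct)
  case empty
  then obtain j where "j \<in> J" by fastforce
  then show ?case by (intro exI[of _ "\<lambda>_. 1"]) auto
next
  case (insert s S)
  show ?case
  proof (cases "\<forall>j\<in>J. a j s = 0")
    case True
    obtain c where "\<exists>j\<in>J. c j \<noteq> 0" "\<forall>t\<in>S. (\<Sum>j\<in>J. c j * a j t) = 0"
      using insert.IH[of J a] insert.prems insert.hyps by auto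
    with True show ?thesis by (intro exI[of _ c]) auto
  next
    case False
    then obtain i where i: "i \<in> J" "a i s \<noteq> 0" by blast
    define J' where "J' = J - {i}"
    have J: "J = insert i J'" "i \<notin> J'" "finite J'" "card S < card J'"
      using i insert.prems insert.hyps by (auto simp: J'_def)
    obtain c where c: "\<exists>j\<in>J'. c j \<noteq> 0"
      "\<And>t. t \<in> S \<Longrightarrow> (\<Sum>j\<in>J'. c j * (a j t - a j s / a i s * a i t)) = 0"
      using insert.IH[of J' "\<lambda>j t. a j t - a j s / a i s * a i t"] J by blast
    \<comment> \<open>Back substitution: the value at \<open>i\<close> is what equation
      \<open>s\<close> forces.\<close>
    define c' where "c' = c(i := - (\<Sum>j\<in>J'. c j * a j s) / a i s)"
    have c': "(\<Sum>j\<in>J. c' j * a j t) = (\<Sum>j\<in>J'. c j * (a j t - a j s / a i s * a i t))" for t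
    proof -
      have "(\<Sum>j\<in>J'. c' j * a j t) = (\<Sum>j\<in>J'. c j * a j t)"
        using J(2) by (intro sum.cong) (auto simp: c'_def)
      then have "(\<Sum>j\<in>J. c' j * a j t)
          = (\<Sum>j\<in>J'. c j * a j t) - (\<Sum>j\<in>J'. c j * a j s) / a i s * a i t"
        using J(1-3) by (simp add: c'_def)
      also have "\<dots> = (\<Sum>j\<in>J'. c j * (a j t - a j s / a i s * a i t))"
        by (simp add: sum_subtractf sum_divide_distrib sum_distrib_right right_diff_distrib mult.assoc)
      finally show ?thesis .
    qed
    have "\<exists>j\<in>J. c' j \<noteq> 0"
      using c(1) J(1,2) by (auto simp: c'_def)
    moreover have "(\<Sum>j\<in>J. c' j * a j t) = 0" if "t \<in> insert s S" for t
      \<comment> \<open>At \<open>t = s\<close> every reduced coefficient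
        \<open>a j s - a j s / a i s * a i s\<close> vanishes.\<close>
      using that c(2) i(2) by (auto simp: c')
    ultimately show ?thesis by blast
  qed
qed

text \<open>It acts on functions of the state, so \<open>(transfer step ^^ n) h v\<close> sums
  \<open>h\<close> over the endpoints of all \<open>n\<close>-step walks from
  \<open>v\<close>.\<close>

definition transfer :: "('a::finite \<Rightarrow> 's \<Rightarrow> 's) \<Rightarrow> ('s \<Rightarrow> 'f::comm_monoid_add) \<Rightarrow> 's \<Rightarrow> 'f" where
  "transfer step h v = (\<Sum>a\<in>UNIV. h (step a v))"

text \<open>One more application of the operator moves the evaluation point to its successors, so
  the relation must hold on a whole closed set, not only at the initial state.\<close>

lemma transfer_relation_propagates:
  fixes h :: "'s \<Rightarrow> 'f::comm_ring_1"
  assumes closed: "\<And>a v. v \<in> S \<Longrightarrow> step a v \<in> S"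
    and rel: "\<And>v. v \<in> S \<Longrightarrow> (\<Sum>j\<in>J. c j * (transfer step ^^ j) h v) = 0"
    and "v \<in> S"
  shows "(\<Sum>j\<in>J. c j * (transfer step ^^ (n + j)) h v) = 0"
  using \<open>v \<in> S\<close>
proof (induction n arbitrary: v)
  case 0
  then show ?case using rel by simp
next
  case (Suc n)
  have "(\<Sum>j\<in>J. c j * (transfer step ^^ (Suc n + j)) h v)
      = (\<Sum>a\<in>UNIV. \<Sum>j\<in>J. c j * (transfer step ^^ (n + j)) h (step a v))"
    by (subst sum.swap) (simp add: transfer_def sum_distrib_left)
  then show ?case using Suc closed by simp
qed

lemma transfer_linear_recurrence:
  fixes h :: "'s \<Rightarrow> 'f::field"
  assumes "finite S" "\<And>a v. v \<in> S \<Longrightarrow> step a v \<in> S" "v \<in> S"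
  shows "satisfies_linear_recurrence_from n0 (\<lambda>n. (transfer step ^^ n) h v)"
proof -
  let ?s = "\<lambda>n. (transfer step ^^ n) h v"
  obtain c where c: "\<exists>j\<le>card S. c j \<noteq> 0"
    "\<And>w. w \<in> S \<Longrightarrow> (\<Sum>j\<le>card S. c j * (transfer step ^^ j) h w) = 0"
    \<comment> \<open>There are \<open>card S + 1\<close> iterates, one more than the dimension of
      the space of functions on \<open>S\<close>.\<close>
    using homogeneous_system_nontrivial_solution[OF assms(1), of "{..card S}"
        "\<lambda>j. (transfer step ^^ j) h"] by auto
  \<comment> \<open>The top index with nonzero coefficient, so that the relation can be solved for
    its highest iterate.\<close>
  define e where "e = (GREATEST j. j \<le> card S \<and> c j \<noteq> 0)"
  have e: "e \<le> card S" "c e \<noteq> 0"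
    using GreatestI_ex_nat[of "\<lambda>j. j \<le> card S \<and> c j \<noteq> 0" "card S"] c(1) by (auto simp: e_def)
  have e_max: "c j = 0" if "j \<le> card S" "e < j" for j
    using that Greatest_le_nat[of "\<lambda>j. j \<le> card S \<and> c j \<noteq> 0" j "card S"] by (force simp: e_def)
  have rel: "(\<Sum>j<e. c j * ?s (n + j)) + c e * ?s (n + e) = 0" for n
  proof -
    have "(\<Sum>j\<le>card S. c j * ?s (n + j)) = (\<Sum>j\<le>e. c j * ?s (n + j))"
      using e(1) e_max by (intro sum.mono_neutral_right) auto
    then show ?thesis
      using transfer_relation_propagates[where S = S and step = step, OF assms(2) c(2) assms(3)]
      by (simp add: lessThan_Suc_atMost[symmetric])
  qed
  \<comment> \<open>The relation may have order \<open>e = 0\<close>; shifting it by one makes the order positive.\<close>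
  define c' where "c' j = (case j of 0 \<Rightarrow> 0 | Suc i \<Rightarrow> - c i / c e)" for j
  have "?s (n + Suc e) = (\<Sum>j<Suc e. c' j * ?s (n + j))" for n
  proof -
    have "(\<Sum>j<Suc e. c' j * ?s (n + j)) = (\<Sum>j<e. - c j / c e * ?s (Suc n + j))"
      by (subst sum.lessThan_Suc_shift) (simp add: c'_def)
    also have "\<dots> = - (\<Sum>j<e. c j * ?s (Suc n + j)) / c e"
      by (simp add: sum_divide_distrib sum_negf)
    also have "- (\<Sum>j<e. c j * ?s (Suc n + j)) = c e * ?s (Suc n + e)"
      using rel[of "Suc n"] by (simp only: minus_unique)
    also have "\<dots> / c e = ?s (n + Suc e)"
      using e(2) by simp
    finally show ?thesis by simp
  qed
  then show ?thesis
    unfolding satisfies_linear_recurrence_from_def by blast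
qed

section \<open>Values of elementary symmetric polynomials\<close>

text \<open>Cancellation can shrink the support of a sum; a common index set makes additivity of
  evaluation a termwise matter.\<close>

lemma mpoly_eval_superset:
  assumes "finite K" "Poly_Mapping.keys F \<subseteq> K"
  shows "mpoly_eval x F = (\<Sum>m\<in>K. Poly_Mapping.lookup F m *
    (\<Prod>i\<in>Poly_Mapping.keys m. x i ^ Poly_Mapping.lookup m i))"
  unfolding mpoly_eval_def
  using assms by (intro sum.mono_neutral_left) (auto simp: in_keys_iff)

lemma mpoly_eval_add: "mpoly_eval x (F + G) = mpoly_eval x F + mpoly_eval x G"
proof -
  let ?K = "Poly_Mapping.keys F \<union> Poly_Mapping.keys G"
  have "Poly_Mapping.keys (F + G) \<subseteq> ?K" by (rule Poly_Mapping.keys_add)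
  then show ?thesis
    by (simp add: mpoly_eval_superset[of ?K] lookup_add distrib_right sum.distrib)
qed

lemma mpoly_eval_sum: "mpoly_eval x (\<Sum>i\<in>I. F i) = (\<Sum>i\<in>I. mpoly_eval x (F i))"
  by (induction I rule: infinite_finite_induct)
    (simp_all add: mpoly_eval_add, simp_all add: mpoly_eval_def)

lemma prod_Var:
  "(\<Prod>i\<in>A. Var i) = Poly_Mapping.single (\<Sum>i\<in>A. Poly_Mapping.single i 1) 1"
  by (induction A rule: infinite_finite_induct)
    (simp_all add: Var_def mult_single single_one)

lemma lookup_sum_single:
  "finite A \<Longrightarrow> Poly_Mapping.lookup (\<Sum>i\<in>A. Poly_Mapping.single i (1::nat)) j = (if j \<in> A then 1 else 0)"
  by (induction A rule: finite_induct) (auto simp: lookup_add lookup_single when_def)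

lemma mpoly_eval_prod_Var:
  assumes "finite A"
  shows "mpoly_eval x (\<Prod>i\<in>A. Var i) = (\<Prod>i\<in>A. x i)"
proof -
  let ?m = "\<Sum>i\<in>A. Poly_Mapping.single i (1::nat)"
  have "Poly_Mapping.keys ?m = A"
    unfolding set_eq_iff in_keys_iff lookup_sum_single[OF assms] by simp
  then show ?thesis
    using assms by (simp add: prod_Var mpoly_eval_def lookup_sum_single del: One_nat_def)
qed

definition esym_val :: "nat \<Rightarrow> nat \<Rightarrow> (nat \<Rightarrow> 'a::comm_semiring_1) \<Rightarrow> 'a" where
  "esym_val n j x = (\<Sum>A | A \<subseteq> {1..n} \<and> card A = j. \<Prod>i\<in>A. x i)"

lemma mpoly_eval_elem_sym: "mpoly_eval x (elem_sym n k) = esym_val n k x"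
  unfolding elem_sym_def esym_val_def mpoly_eval_sum
  by (intro sum.cong refl mpoly_eval_prod_Var) (auto intro: finite_subset)

lemma esym_val_0_right: "esym_val n 0 x = 1"
proof -
  have "{A. A \<subseteq> {1..n} \<and> card A = 0} = {{}}"
    by (auto dest: finite_subset)
  then show ?thesis by (simp add: esym_val_def)
qed

lemma esym_val_0_left: "esym_val 0 j x = (if j = 0 then 1 else 0)"
proof (cases "j = 0")
  case False
  then have "{A. A \<subseteq> {1..0::nat} \<and> card A = j} = {}" by auto
  with False show ?thesis by (simp only: esym_val_def sum.empty if_False)
qed (simp add: esym_val_0_right)

lemma esym_val_fun_upd: "esym_val n j (x(Suc n := a)) = esym_val n j x"
  unfolding esym_val_def by (intro sum.cong prod.cong) auto

text \<open>The subsets of \<open>{1..Suc n}\<close> are split by whether they contain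
  \<open>Suc n\<close>; those that do form \<open>?Q\<close>.\<close>

lemma esym_val_Suc_Suc:
  "esym_val (Suc n) (Suc j) x = esym_val n (Suc j) x + x (Suc n) * esym_val n j x"
proof -
  let ?P = "\<lambda>n j. {A. A \<subseteq> {1..n} \<and> card A = j}"
  let ?Q = "insert (Suc n) ` ?P n j"
  have fin: "finite A" "Suc n \<notin> A" if "A \<in> ?P n i" for A i
    using that by (auto intro: finite_subset)
  have "?P (Suc n) (Suc j) = ?P n (Suc j) \<union> ?Q"
  proof (intro equalityI subsetI)
    fix A assume A: "A \<in> ?P (Suc n) (Suc j)"
    show "A \<in> ?P n (Suc j) \<union> ?Q"
    proof (cases "Suc n \<in> A")
      case True
      then have "A = insert (Suc n) (A - {Suc n})" "A - {Suc n} \<in> ?P n j"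
        using A by (auto simp: atLeastAtMostSuc_conv)
      then show ?thesis by blast
    qed (use A in \<open>auto simp: atLeastAtMostSuc_conv\<close>)
  next
    fix A assume "A \<in> ?P n (Suc j) \<union> ?Q"
    then show "A \<in> ?P (Suc n) (Suc j)"
    proof
      assume "A \<in> ?Q"
      then obtain B where "A = insert (Suc n) B" "B \<in> ?P n j" by blast
      then show ?thesis using fin[of B j] by auto
    qed auto
  qed
  moreover have "?P n (Suc j) \<inter> ?Q = {}" by fastforce
  ultimately have "esym_val (Suc n) (Suc j) x = esym_val n (Suc j) x + (\<Sum>A\<in>?Q. \<Prod>i\<in>A. x i)"
    unfolding esym_val_def by (simp only:) (intro sum.union_disjoint, auto)
  also have "(\<Sum>A\<in>?Q. \<Prod>i\<in>A. x i) = (\<Sum>A\<in>?P n j. \<Prod>i\<in>insert (Suc n) A. x i)"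
  proof (rule sum.reindex_cong[OF _ refl refl])
    show "inj_on (insert (Suc n)) (?P n j)"
      by (rule inj_onI) (use fin(2)[of _ j] in \<open>simp only: insert_ident not_False_eq_True\<close>)
  qed
  also have "\<dots> = x (Suc n) * esym_val n j x"
    unfolding esym_val_def sum_distrib_left using fin by (intro sum.cong refl prod.insert) blast+
  finally show ?thesis .
qed

section \<open>The walk on truncated vectors of symmetric values\<close>

text \<open>Zero padding above \<open>k\<close> keeps states as plain functions while leaving only
  finitely many of them over a finite ring.\<close>

definition esym_states :: "nat \<Rightarrow> (nat \<Rightarrow> 'a::zero) set" where
  "esym_states k = {v. \<forall>j>k. v j = 0}"

definition esym_state :: "nat \<Rightarrow> nat \<Rightarrow> (nat \<Rightarrow> 'a::comm_semiring_1) \<Rightarrow> nat \<Rightarrow> 'a" where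
  "esym_state k n x j = (if j \<le> k then esym_val n j x else 0)"

text \<open>With \<open>v\<close> read as the polynomial with coefficients \<open>v j\<close> in T,
  this is multiplication by 1 + aT modulo T to the power k + 1.\<close>

definition esym_step :: "nat \<Rightarrow> 'a::comm_semiring_1 \<Rightarrow> (nat \<Rightarrow> 'a) \<Rightarrow> nat \<Rightarrow> 'a" where
  "esym_step k a v j = (if j \<le> k then v j + (case j of 0 \<Rightarrow> 0 | Suc i \<Rightarrow> a * v i) else 0)"

lemma finite_esym_states: "finite (esym_states k :: (nat \<Rightarrow> 'a::{zero,finite}) set)"
proof -
  have "esym_states k = {v :: nat \<Rightarrow> 'a. \<forall>j. (j \<in> {..k} \<longrightarrow> v j \<in> UNIV) \<and> (j \<notin> {..k} \<longrightarrow> v j = 0)}"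
    by (auto simp: esym_states_def)
  then show ?thesis using finite_set_of_finite_funs[of "{..k}" "UNIV :: 'a set" 0] by simp
qed

lemma esym_state_Suc:
  "esym_state k (Suc n) (x(Suc n := a)) = esym_step k a (esym_state k n x)"
proof
  fix j
  show "esym_state k (Suc n) (x(Suc n := a)) j = esym_step k a (esym_state k n x) j"
    by (cases j) (auto simp: esym_state_def esym_step_def esym_val_0_right esym_val_Suc_Suc esym_val_fun_upd)
qed

lemma sum_PiE_atLeastAtMost_Suc:
  fixes g :: "(nat \<Rightarrow> 'a::finite) \<Rightarrow> 'b::comm_monoid_add"
  shows "(\<Sum>x \<in> {1..Suc n} \<rightarrow>\<^sub>E UNIV. g x)
    = (\<Sum>x \<in> {1..n} \<rightarrow>\<^sub>E UNIV. \<Sum>a\<in>UNIV. g (x(Suc n := a)))"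
proof -
  have "{1..Suc n} \<rightarrow>\<^sub>E (UNIV :: 'a set)
      = (\<lambda>(a, x). x(Suc n := a)) ` (UNIV \<times> ({1..n} \<rightarrow>\<^sub>E UNIV))"
    by (simp add: atLeastAtMostSuc_conv PiE_insert_eq)
  moreover have "inj_on (\<lambda>(a, x). x(Suc n := a)) (UNIV \<times> ({1..n} \<rightarrow>\<^sub>E (UNIV :: 'a set)))"
    using inj_combinator[of "Suc n" "{1..n}" "\<lambda>_. UNIV :: 'a set"] by simp
  ultimately have "(\<Sum>x \<in> {1..Suc n} \<rightarrow>\<^sub>E UNIV. g x)
      = (\<Sum>(a, x) \<in> UNIV \<times> ({1..n} \<rightarrow>\<^sub>E UNIV). g (x(Suc n := a)))"
    by (simp add: sum.reindex case_prod_unfold)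
  also have "\<dots> = (\<Sum>x \<in> {1..n} \<rightarrow>\<^sub>E UNIV. \<Sum>a\<in>UNIV. g (x(Suc n := a)))"
    by (subst sum.swap) (simp add: sum.cartesian_product)
  finally show ?thesis .
qed

text \<open>Summing out the last variable replaces \<open>h\<close> by
  \<open>transfer (esym_step k) h\<close>, hence the induction over arbitrary \<open>h\<close>. The
  start vector is the state with no variables.\<close>

lemma sum_esym_state_eq_transfer:
  fixes h :: "(nat \<Rightarrow> 'a::{comm_semiring_1,finite}) \<Rightarrow> 'f::comm_monoid_add"
  shows "(\<Sum>x \<in> {1..n} \<rightarrow>\<^sub>E UNIV. h (esym_state k n x))
    = (transfer (esym_step k) ^^ n) h (\<lambda>j. if j = 0 then 1 else 0)"
proof (induction n arbitrary: h)
  case 0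
  have "esym_state k 0 x = (\<lambda>j. if j = 0 then 1 else 0)" for x :: "nat \<Rightarrow> 'a"
    by (auto simp: esym_state_def esym_val_0_left)
  then show ?case by simp
next
  case (Suc n)
  have "(\<Sum>x \<in> {1..Suc n} \<rightarrow>\<^sub>E UNIV. h (esym_state k (Suc n) x))
      = (\<Sum>x \<in> {1..n} \<rightarrow>\<^sub>E UNIV. transfer (esym_step k) h (esym_state k n x))"
    by (simp only: sum_PiE_atLeastAtMost_Suc esym_state_Suc transfer_def)
  also have "\<dots> = (transfer (esym_step k) ^^ Suc n) h (\<lambda>j. if j = 0 then 1 else 0)"
    by (simp only: Suc.IH funpow_Suc_right comp_apply)
  finally show ?case .
qed

theorem theorem4p1:
  fixes k p r :: nat
  assumes "k \<ge> 2" and "prime p" and "r \<ge> 1"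
    and "CARD('a::finite_field) = p ^ r"
  shows "satisfies_linear_recurrence_from k
           (\<lambda>n. exp_sum p r n (elem_sym n k :: 'a mpoly))"
proof -
  define h :: "(nat \<Rightarrow> 'a) \<Rightarrow> complex" where
    "h v = exp (2 * of_real pi * \<i> / of_nat p *
       of_nat (prime_field_rep p (field_trace p r (v k))))" for v
  have "exp_sum p r n (elem_sym n k :: 'a mpoly)
      = (transfer (esym_step k) ^^ n) h (\<lambda>j. if j = 0 then 1 else 0)" for n
    unfolding sum_esym_state_eq_transfer[symmetric]
    by (simp add: exp_sum_def h_def mpoly_eval_elem_sym esym_state_def)
  moreover have "satisfies_linear_recurrence_from k
      (\<lambda>n. (transfer (esym_step k) ^^ n) h (\<lambda>j. if j = 0 then 1 else 0))"
    \<comment> \<open>What remains is that \<open>esym_states k\<close> is closed under steps and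
      contains the start vector.\<close>
    by (rule transfer_linear_recurrence[OF finite_esym_states[of k]])
      (auto simp: esym_states_def esym_step_def)
  ultimately show ?thesis by simp
qed

end
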